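(* Let $p\in(0,1)$ and let $f$ be a continuously differentiable real function on a neighbourhood of $[-1,1]^n$. Define $I_p(y)=\sum_{i=1}^n I_p(y_i)$ for $y\in\mathbb{R}^n$, where for $x\in[-1,1]$, $I_p(x)=\frac{1+x}{2}\log\frac{1+x}{2p}+\frac{1-x}{2}\log\frac{1-x}{2(1-p)}$ and $I_p(x)=+\infty$ otherwise, and define $\phi_p(t)=\inf\{I_p(y): f(y)\ge t,\ y\in[-1,1]^n\}$ for $t\in\mathbb{R}$. Let $t\in\mathbb{R}$, $\delta>0$, and assume $\phi_p(s)>\phi_p(t-\delta)$ for all $s>t-\delta$. Let $V=\nabla f([-1,1]^n)$, $L=\sup_{x\in[-1,1]^n}\|\nabla f(x)\|_{\ell^2}$, and let $X$ be a random vector with law $\mu_p^n$, where $\mu_p=(1-p)\delta_{-1}+p\delta_1$. There exist universal constants $C,\kappa>0$ such that if $b(V)\le\delta/\kappa$, then $$\log\mathbb{P}(f(X)\ge t)\le-\phi_p(t-\delta)+C\log\Big(\frac{nL\log(1/(p(1-p)))}{\delta}\Big).$$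
   Context: $b(V)=\mathbb{E}\sup_{\xi\in V}\langle\xi,\varepsilon\rangle$ with $\varepsilon$ uniformly distributed on $\{-1,1\}^n$. *)

theory Defs
  imports "HOL-Analysis.Analysis" "HOL-Probability.Probability"
begin

definition inRn :: "nat \<Rightarrow> (nat \<Rightarrow> real) \<Rightarrow> bool" where
  "inRn n x \<longleftrightarrow> (\<forall>i\<ge>n. x i = 0)"

definition l2n :: "nat \<Rightarrow> (nat \<Rightarrow> real) \<Rightarrow> real" where
  "l2n n x = sqrt (\<Sum>i<n. (x i)^2)"

definition cube :: "nat \<Rightarrow> (nat \<Rightarrow> real) set" where
  "cube n = {x. inRn n x \<and> (\<forall>i<n. -1 \<le> x i \<and> x i \<le> 1)}"

text \<open>open box (-1-e,1+e)^n, a basic open neighbourhood of the cube\<close>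
definition obox :: "nat \<Rightarrow> real \<Rightarrow> (nat \<Rightarrow> real) set" where
  "obox n e = {x. inRn n x \<and> (\<forall>i<n. \<bar>x i\<bar> < 1 + e)}"

definition has_gradient_n :: "nat \<Rightarrow> ((nat \<Rightarrow> real) \<Rightarrow> real) \<Rightarrow> (nat \<Rightarrow> real) \<Rightarrow> (nat \<Rightarrow> real) \<Rightarrow> bool" where
  "has_gradient_n n f v x \<longleftrightarrow> inRn n v \<and>
     (\<forall>e>0. \<exists>d>0. \<forall>h. inRn n h \<and> l2n n h < d \<longrightarrow>
        \<bar>f (\<lambda>i. x i + h i) - f x - (\<Sum>i<n. v i * h i)\<bar> \<le> e * l2n n h)"

definition C1_near_cube :: "nat \<Rightarrow> ((nat \<Rightarrow> real) \<Rightarrow> real) \<Rightarrow> ((nat \<Rightarrow> real) \<Rightarrow> (nat \<Rightarrow> real)) \<Rightarrow> bool" where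
  "C1_near_cube n f g \<longleftrightarrow> (\<exists>\<epsilon>>0.
     (\<forall>x\<in>obox n \<epsilon>. has_gradient_n n f (g x) x) \<and>
     (\<forall>x\<in>obox n \<epsilon>. \<forall>e>0. \<exists>d>0. \<forall>y\<in>obox n \<epsilon>. l2n n (\<lambda>i. y i - x i) < d \<longrightarrow> l2n n (\<lambda>i. g y i - g x i) < e))"

definition Ip1 :: "real \<Rightarrow> real \<Rightarrow> real" where
  "Ip1 p x = (1 + x) / 2 * ln ((1 + x) / (2 * p)) + (1 - x) / 2 * ln ((1 - x) / (2 * (1 - p)))"

definition Ip :: "nat \<Rightarrow> real \<Rightarrow> (nat \<Rightarrow> real) \<Rightarrow> ereal" where
  "Ip n p y = (if y \<in> cube n then ereal (\<Sum>i<n. Ip1 p (y i)) else \<infinity>)"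

definition phi :: "nat \<Rightarrow> real \<Rightarrow> ((nat \<Rightarrow> real) \<Rightarrow> real) \<Rightarrow> real \<Rightarrow> ereal" where
  "phi n p f t = Inf {Ip n p y | y. f y \<ge> t \<and> y \<in> cube n}"

definition mu :: "real \<Rightarrow> real pmf" where
  "mu p = map_pmf (\<lambda>b. if b then 1 else -1) (bernoulli_pmf p)"

definition mu_n :: "nat \<Rightarrow> real \<Rightarrow> (nat \<Rightarrow> real) pmf" where
  "mu_n n p = Pi_pmf {..<n} 0 (\<lambda>_. mu p)"

definition bV :: "nat \<Rightarrow> (nat \<Rightarrow> real) set \<Rightarrow> real" where
  "bV n V = measure_pmf.expectation (mu_n n (1/2)) (\<lambda>\<epsilon>. SUP \<xi>\<in>V. (\<Sum>i<n. \<xi> i * \<epsilon> i))"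

end

theory Submission
  imports Defs
begin

text \<open>Let \<open>lam\<close> be the log-Laplace transform of \<open>mu p\<close>, the convex conjugate of \<open>Ip1 p\<close>,
  and \<open>\<Lambda>(\<zeta>)\<close> the sum of \<open>lam\<close> over the coordinates of \<open>\<zeta>\<close>. Coordinate by coordinate,
  the Gibbs variational principle and a comparison in convex order give, for every finite family \<open>T\<close>,
  \<open>log E exp (max (\<langle>\<zeta>, X\<rangle> - \<Lambda>(\<zeta>))) \<le> E max 2 \<langle>\<zeta>, \<epsilon>\<rangle>\<close>, the maxima being over \<open>\<zeta> \<in> T\<close>.

  Put \<open>r = phi (t - \<delta>)\<close>. The strictness hypothesis says that \<open>f \<le> t - \<delta>\<close> on the convex body \<open>{I \<le> r}\<close>.
  So if \<open>f x \<ge> t\<close>, the mean value theorem provides for each \<open>y\<close> in the body a gradient \<open>v\<close> with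
  \<open>\<langle>v, x - y\<rangle> \<ge> \<delta>\<close>, and minimax duality yields \<open>l \<ge> 0\<close> and \<open>\<zeta>\<close> in \<open>l\<close> times the hull of the gradients with
  \<open>\<langle>\<zeta>, x\<rangle> - \<Lambda>(\<zeta>) \<ge> r + l \<delta> / 2 - O(1)\<close>. For fixed \<open>l\<close> such points have probability at most
  \<open>exp (2 l b(V) - r - l \<delta> / 2 + O(1))\<close>, which is \<open>O(exp (- r))\<close> when \<open>b(V) \<le> \<delta> / 4\<close>. Since \<open>l\<close> may be rounded to a
  grid of polynomially many values, a union bound costs only the logarithmic term; constants are
  absorbed because the argument of the logarithm is at least \<open>21/20\<close>.\<close>

section \<open>Entropy and its convex conjugate\<close>

definition lam :: "real \<Rightarrow> real \<Rightarrow> real" where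
  "lam p u = ln (p * exp u + (1 - p) * exp (- u))"

text \<open>The derivative of \<open>lam p\<close> at \<open>u\<close>, that is, the mean of
  \<open>mu p\<close> after reweighting by \<open>exp (u * x)\<close> and normalising.\<close>

definition tilt :: "real \<Rightarrow> real \<Rightarrow> real" where
  "tilt p u = (p * exp u - (1 - p) * exp (- u)) / (p * exp u + (1 - p) * exp (- u))"

lemma partition_pos:
  fixes p u :: real
  assumes "0 < p" "p < 1"
  shows "0 < p * exp u + (1 - p) * exp (- u)"
  using assms by (intro add_pos_pos mult_pos_pos) auto

lemma lam_0: "lam p 0 = 0"
  by (simp add: lam_def)

lemma tilt_weights:
  assumes "0 < p" "p < 1"
  shows "(1 + tilt p u) / 2 = p * exp u / (p * exp u + (1 - p) * exp (- u))"
    and "(1 - tilt p u) / 2 = (1 - p) * exp (- u) / (p * exp u + (1 - p) * exp (- u))"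
  using partition_pos[OF assms, of u] by (simp_all add: tilt_def field_simps)

lemma tilt_bounds:
  assumes "0 < p" "p < 1"
  shows "-1 < tilt p u" "tilt p u < 1"
proof -
  have "0 < (1 + tilt p u) / 2" "0 < (1 - tilt p u) / 2"
    unfolding tilt_weights[OF assms] using partition_pos[OF assms, of u] assms by simp_all
  then show "-1 < tilt p u" "tilt p u < 1" by simp_all
qed

lemma ln_tilt_weights:
  assumes "0 < p" "p < 1"
  shows "ln ((1 + tilt p u) / (2 * p)) = u - lam p u"
    and "ln ((1 - tilt p u) / (2 * (1 - p))) = - u - lam p u"
proof -
  have "(1 + tilt p u) / (2 * p) = ((1 + tilt p u) / 2) / p" by simp
  also have "\<dots> = exp u / (p * exp u + (1 - p) * exp (- u))"
    unfolding tilt_weights(1)[OF assms] using assms by simp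
  finally have "(1 + tilt p u) / (2 * p) = exp u / (p * exp u + (1 - p) * exp (- u))" .
  then show "ln ((1 + tilt p u) / (2 * p)) = u - lam p u"
    using partition_pos[OF assms, of u] by (simp add: lam_def ln_div)
  have "(1 - tilt p u) / (2 * (1 - p)) = ((1 - tilt p u) / 2) / (1 - p)" by simp
  also have "\<dots> = exp (- u) / (p * exp u + (1 - p) * exp (- u))"
    unfolding tilt_weights(2)[OF assms] using assms by simp
  finally have "(1 - tilt p u) / (2 * (1 - p)) = exp (- u) / (p * exp u + (1 - p) * exp (- u))" .
  then show "ln ((1 - tilt p u) / (2 * (1 - p))) = - u - lam p u"
    using partition_pos[OF assms, of u] by (simp add: lam_def ln_div)
qed

lemma Ip1_tilt:
  assumes "0 < p" "p < 1"
  shows "Ip1 p (tilt p u) = u * tilt p u - lam p u"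
  unfolding Ip1_def ln_tilt_weights[OF assms] by (simp add: field_simps)

lemma mult_ln_quotient_ge:
  fixes a b :: real
  assumes "0 \<le> a" "0 < b"
  shows "a - b \<le> a * ln (a / b)"
proof (cases "a = 0")
  case False
  then have "0 < a" using assms by simp
  have "ln (b / a) \<le> b / a - 1" using \<open>0 < a\<close> assms by (intro ln_le_minus_one) simp
  then have "a * ln (b / a) \<le> b - a"
    using \<open>0 < a\<close> by (simp add: field_simps)
  then show ?thesis using \<open>0 < a\<close> assms by (simp add: ln_div algebra_simps)
qed (use assms in simp)

text \<open>The gap is the relative entropy of the two-point law with mean \<open>m\<close> with
  respect to the one with mean \<open>tilt p u\<close>; \<open>mult_ln_quotient_ge\<close>, summed
  over the two atoms, makes it nonnegative.\<close>

lemma fenchel_young: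
  assumes "0 < p" "p < 1" "-1 \<le> m" "m \<le> 1"
  shows "u * m - lam p u \<le> Ip1 p m"
proof -
  define y where "y = tilt p u"
  have y: "-1 < y" "y < 1" using tilt_bounds[OF assms(1,2)] by (auto simp: y_def)
  have split: "a * ln (a / b) = a * ln (a / c) - a * ln (b / c)" if "0 \<le> a" "0 < b" "0 < c" for a b c :: real
    using that by (cases "a = 0") (auto simp: ln_div algebra_simps)
  have "(1 + m) / 2 - (1 + y) / 2 \<le> (1 + m) / 2 * ln ((1 + m) / 2 / ((1 + y) / 2))"
    using assms y by (intro mult_ln_quotient_ge) auto
  moreover have "(1 - m) / 2 - (1 - y) / 2 \<le> (1 - m) / 2 * ln ((1 - m) / 2 / ((1 - y) / 2))"
    using assms y by (intro mult_ln_quotient_ge) auto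
  moreover have "(1 + m) / 2 * ln ((1 + m) / 2 / ((1 + y) / 2))
      = (1 + m) / 2 * ln ((1 + m) / (2 * p)) - (1 + m) / 2 * (u - lam p u)"
    using split[of "(1 + m) / 2" "(1 + y) / 2" p] assms y ln_tilt_weights(1)[OF assms(1,2), of u]
    by (simp add: y_def)
  moreover have "(1 - m) / 2 * ln ((1 - m) / 2 / ((1 - y) / 2))
      = (1 - m) / 2 * ln ((1 - m) / (2 * (1 - p))) - (1 - m) / 2 * (- u - lam p u)"
    using split[of "(1 - m) / 2" "(1 - y) / 2" "1 - p"] assms y ln_tilt_weights(2)[OF assms(1,2), of u]
    by (simp add: y_def)
  ultimately show ?thesis unfolding Ip1_def by (simp add: field_simps)
qed

lemma Ip1_nonneg:
  assumes "0 < p" "p < 1" "-1 \<le> m" "m \<le> 1"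
  shows "0 \<le> Ip1 p m"
  using fenchel_young[OF assms, of 0] by (simp add: lam_0)

lemma Ip1_mean:
  assumes "0 < p" "p < 1"
  shows "Ip1 p (2 * p - 1) = 0"
  using assms by (simp add: Ip1_def)

lemma exp_le_quadratic:
  fixes w :: real
  assumes "\<bar>w\<bar> \<le> 1"
  shows "exp w \<le> 1 + w + w\<^sup>2"
proof (cases "0 \<le> w")
  case True
  then show ?thesis using exp_bound[of w] assms by simp
next
  case False
  \<comment> \<open>For negative \<open>w\<close> the claim is multiplied by
    \<open>exp (- w)\<close>, so a lower Taylor bound for that factor suffices.\<close>
  have "1 \<le> (1 - w + w\<^sup>2 / 2) * (1 + w + w\<^sup>2)"
  proof -
    have "(1 - w + w\<^sup>2 / 2) * (1 + w + w\<^sup>2) = 1 + w\<^sup>2 / 2 * (1 - w + w\<^sup>2)"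
      by (simp add: field_simps power2_eq_square)
    moreover have "0 \<le> w\<^sup>2 / 2 * (1 - w + w\<^sup>2)"
      using False by (intro mult_nonneg_nonneg) auto
    ultimately show ?thesis by simp
  qed
  also have "\<dots> \<le> exp (- w) * (1 + w + w\<^sup>2)"
    using exp_lower_Taylor_quadratic[of "- w"] False assms
    by (intro mult_right_mono) (auto intro: add_nonneg_nonneg)
  finally show ?thesis by (simp add: exp_minus field_simps)
qed

text \<open>The increment of \<open>lam p\<close> is the log-Laplace transform at \<open>w\<close>
  of the tilted law with weights \<open>q\<close> and \<open>1 - q\<close>;
  \<open>exp_le_quadratic\<close> and \<open>1 + a \<le> exp a\<close> bound it.\<close>

lemma lam_smooth:
  assumes "0 < p" "p < 1" "\<bar>w\<bar> \<le> 1"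
  shows "lam p (u + w) \<le> lam p u + tilt p u * w + w\<^sup>2"
proof -
  define Z where "Z = p * exp u + (1 - p) * exp (- u)"
  define q where "q = (1 + tilt p u) / 2"
  have Z: "0 < Z" using partition_pos[OF assms(1,2)] by (simp add: Z_def)
  have qZ: "p * exp u = q * Z" "(1 - p) * exp (- u) = (1 - q) * Z"
    using tilt_weights[OF assms(1,2), of u] Z by (auto simp: Z_def q_def field_simps)
  have q: "0 \<le> q" "q \<le> 1" using tilt_bounds[OF assms(1,2), of u] by (auto simp: q_def)
  have exp_neg: "exp (- (u + w)) = exp (- u) * exp (- w)"
    by (simp flip: exp_add)
  have "p * exp (u + w) + (1 - p) * exp (- (u + w)) = (p * exp u) * exp w + ((1 - p) * exp (- u)) * exp (- w)"
    by (simp only: exp_neg exp_add mult.assoc)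
  also have "\<dots> = Z * (q * exp w + (1 - q) * exp (- w))"
    unfolding qZ by (simp add: algebra_simps)
  also have "\<dots> \<le> Z * (q * (1 + w + w\<^sup>2) + (1 - q) * (1 - w + w\<^sup>2))"
    using exp_le_quadratic[of w] exp_le_quadratic[of "- w"] assms q Z
    by (intro mult_left_mono add_mono) auto
  also have "\<dots> = Z * (1 + (tilt p u * w + w\<^sup>2))"
    by (simp add: q_def field_simps)
  also have "\<dots> \<le> Z * exp (tilt p u * w + w\<^sup>2)"
    using Z exp_ge_add_one_self by (intro mult_left_mono) auto
  finally have "lam p (u + w) \<le> ln (Z * exp (tilt p u * w + w\<^sup>2))"
    unfolding lam_def using partition_pos[OF assms(1,2), of "u + w"] by (subst ln_le_cancel_iff) (use Z in auto)
  also have "\<dots> = lam p u + tilt p u * w + w\<^sup>2"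
    using Z by (simp add: ln_mult lam_def Z_def)
  finally show ?thesis .
qed

lemma lam_lipschitz:
  assumes "0 < p" "p < 1"
  shows "lam p (u + w) \<le> lam p u + \<bar>w\<bar>"
proof -
  define Z where "Z = p * exp u + (1 - p) * exp (- u)"
  have Z: "0 < Z" using partition_pos[OF assms(1,2)] by (simp add: Z_def)
  have exp_neg: "exp (- (u + w)) = exp (- u) * exp (- w)"
    by (simp flip: exp_add)
  have "p * exp (u + w) + (1 - p) * exp (- (u + w)) = p * exp u * exp w + (1 - p) * exp (- u) * exp (- w)"
    by (simp only: exp_neg exp_add mult.assoc)
  also have "\<dots> \<le> p * exp u * exp \<bar>w\<bar> + (1 - p) * exp (- u) * exp \<bar>w\<bar>"
    using assms by (intro add_mono mult_left_mono) auto
  also have "\<dots> = Z * exp \<bar>w\<bar>" by (simp add: Z_def algebra_simps)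
  finally have "lam p (u + w) \<le> ln (Z * exp \<bar>w\<bar>)"
    unfolding lam_def using partition_pos[OF assms(1,2), of "u + w"] by (subst ln_le_cancel_iff) (use Z in auto)
  also have "\<dots> = lam p u + \<bar>w\<bar>"
    using Z by (simp add: ln_mult lam_def Z_def)
  finally show ?thesis .
qed

text \<open>The equality case of the Gibbs principle, with \<open>m\<close> the optimal mean. For
  fixed \<open>m\<close> the exponent is affine in \<open>A\<close> and \<open>B\<close>, hence
  compatible with expectations.\<close>

lemma gibbs_variational:
  fixes A B :: real
  assumes "0 < p" "p < 1"
  defines "m \<equiv> tilt p ((A - B) / 2)"
  shows "p * exp A + (1 - p) * exp B = exp ((1 + m) / 2 * A + (1 - m) / 2 * B - Ip1 p m)"
proof -
  define u where "u = (A - B) / 2"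
  have "p * exp A + (1 - p) * exp B = exp ((A + B) / 2) * (p * exp u + (1 - p) * exp (- u))"
    by (simp add: u_def distrib_left flip: exp_add) (simp add: field_simps exp_add[symmetric])
  also have "\<dots> = exp ((A + B) / 2 + lam p u)"
    using partition_pos[OF assms(1,2), of u] by (simp add: exp_add lam_def)
  also have "(A + B) / 2 + lam p u = (1 + m) / 2 * A + (1 - m) / 2 * B - Ip1 p m"
    unfolding m_def Ip1_tilt[OF assms(1,2)] by (simp add: u_def field_simps)
  finally show ?thesis .
qed

section \<open>Exponential integrability of Bernoulli processes\<close>

lemma finite_set_mu_n: "finite (set_pmf (mu_n n p))"
  unfolding mu_n_def set_Pi_pmf[OF finite_lessThan]
  by (intro finite_PiE_dflt) (auto simp: mu_def)

lemma integrable_mu_n [simp]: "integrable (measure_pmf (mu_n n p)) (F :: (nat \<Rightarrow> real) \<Rightarrow> real)"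
  by (rule integrable_measure_pmf_finite[OF finite_set_mu_n])

lemma set_mu_n:
  assumes "0 < p" "p < 1" "x \<in> set_pmf (mu_n n p)"
  shows "inRn n x" "i < n \<Longrightarrow> x i = 1 \<or> x i = -1"
  using assms unfolding mu_n_def set_Pi_pmf[OF finite_lessThan]
  by (auto simp: mu_def PiE_dflt_def inRn_def)

lemma expectation_mu_n_0: "measure_pmf.expectation (mu_n 0 p) F = (F (\<lambda>_. 0) :: real)"
  by (simp add: mu_n_def)

lemma expectation_mu_n_Suc:
  fixes F :: "(nat \<Rightarrow> real) \<Rightarrow> real"
  assumes "0 < p" "p < 1"
  shows "measure_pmf.expectation (mu_n (Suc n) p) F =
    p * measure_pmf.expectation (mu_n n p) (\<lambda>x. F (x(n := 1))) +
    (1 - p) * measure_pmf.expectation (mu_n n p) (\<lambda>x. F (x(n := -1)))"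
proof -
  have "mu_n (Suc n) p = bernoulli_pmf p \<bind>
      (\<lambda>b. map_pmf (\<lambda>x. x(n := if b then 1 else -1)) (mu_n n p))"
    unfolding mu_n_def lessThan_Suc
    by (subst Pi_pmf_insert') (auto simp: mu_def map_pmf_def bind_assoc_pmf bind_return_pmf)
  then show ?thesis
    using assms
    by (simp add: pmf_expectation_bind[of UNIV] finite_set_mu_n UNIV_bool)
qed

lemma Max_image_le:
  fixes F :: "'a \<Rightarrow> real"
  assumes "finite T" "T \<noteq> {}" "\<And>k. k \<in> T \<Longrightarrow> F k \<le> c"
  shows "Max (F ` T) \<le> c"
  using assms by simp

lemma Max_image_ge:
  fixes F :: "'a \<Rightarrow> real"
  assumes "finite T" "k \<in> T"
  shows "F k \<le> Max (F ` T)"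
  using assms by simp

text \<open>Fenchel--Young replaces the steps \<open>\<plusminus>1\<close> minus \<open>lam\<close> by the centred steps \<open>\<plusminus>1 - m\<close> at the cost of the
  entropy \<open>Ip1 p m\<close>; a centred step with values in \<open>[-2, 2]\<close> is dominated in convex order by \<open>\<plusminus>2\<close>.\<close>

lemma two_point_decoupling:
  fixes a v :: "'a \<Rightarrow> real"
  assumes T: "finite T" "T \<noteq> {}" and p: "0 < p" "p < 1" and m: "-1 \<le> m" "m \<le> 1"
  shows "(1 + m) / 2 * (MAX k\<in>T. a k + (v k - lam p (v k)))
      + (1 - m) / 2 * (MAX k\<in>T. a k + (- v k - lam p (v k))) - Ip1 p m
    \<le> ((MAX k\<in>T. a k + 2 * v k) + (MAX k\<in>T. a k - 2 * v k)) / 2"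
proof -
  define P where "P = (MAX k\<in>T. a k + 2 * v k)"
  define N where "N = (MAX k\<in>T. a k - 2 * v k)"
  \<comment> \<open>The left side is the average of its values at \<open>z = 2\<close> and
    \<open>z = -2\<close> with weights \<open>(2 + z) / 4\<close> and
    \<open>(2 - z) / 4\<close>.\<close>
  have aff: "a k + v k * z \<le> (2 + z) / 4 * P + (2 - z) / 4 * N" if "k \<in> T" "-2 \<le> z" "z \<le> 2" for k z
  proof -
    have "(2 + z) / 4 * (a k + 2 * v k) \<le> (2 + z) / 4 * P"
      unfolding P_def using that by (intro mult_left_mono Max_image_ge T) auto
    moreover have "(2 - z) / 4 * (a k - 2 * v k) \<le> (2 - z) / 4 * N"
      unfolding N_def using that by (intro mult_left_mono Max_image_ge T) auto
    ultimately show ?thesis by (simp add: field_simps)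
  qed
  have up: "(MAX k\<in>T. a k + (v k - lam p (v k))) \<le> (3 - m) / 4 * P + (1 + m) / 4 * N + Ip1 p m"
  proof (rule Max_image_le[OF T])
    fix k assume "k \<in> T"
    then show "a k + (v k - lam p (v k)) \<le> (3 - m) / 4 * P + (1 + m) / 4 * N + Ip1 p m"
      using aff[of k "1 - m"] fenchel_young[OF p m, of "v k"] m by (simp add: field_simps)
  qed
  have down: "(MAX k\<in>T. a k + (- v k - lam p (v k))) \<le> (1 - m) / 4 * P + (3 + m) / 4 * N + Ip1 p m"
  proof (rule Max_image_le[OF T])
    fix k assume "k \<in> T"
    then show "a k + (- v k - lam p (v k)) \<le> (1 - m) / 4 * P + (3 + m) / 4 * N + Ip1 p m"
      using aff[of k "- 1 - m"] fenchel_young[OF p m, of "v k"] m by (simp add: field_simps)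
  qed
  have "(1 + m) / 2 * (MAX k\<in>T. a k + (v k - lam p (v k)))
      + (1 - m) / 2 * (MAX k\<in>T. a k + (- v k - lam p (v k))) - Ip1 p m
    \<le> (1 + m) / 2 * ((3 - m) / 4 * P + (1 + m) / 4 * N + Ip1 p m)
      + (1 - m) / 2 * ((1 - m) / 4 * P + (3 + m) / 4 * N + Ip1 p m) - Ip1 p m"
    using m by (intro diff_right_mono add_mono mult_left_mono up down) auto
  \<comment> \<open>The steps \<open>1 - m\<close> and \<open>- 1 - m\<close> average to zero, so
    \<open>P\<close> and \<open>N\<close> receive equal weight; the entropy terms cancel.\<close>
  also have "\<dots> = (P + N) / 2"
    by (simp add: field_simps)
  finally show ?thesis unfolding P_def N_def .
qed

text \<open>Induction on the dimension, splitting off the last coordinate; the offsets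
  \<open>c\<close> are arbitrary so that they can absorb its contribution.\<close>

lemma bernoulli_process_integrability:
  fixes v :: "'a \<Rightarrow> nat \<Rightarrow> real" and c :: "'a \<Rightarrow> real"
  assumes T: "finite T" "T \<noteq> {}" and p: "0 < p" "p < 1"
  shows "measure_pmf.expectation (mu_n n p)
      (\<lambda>x. exp (MAX k\<in>T. (\<Sum>i<n. v k i * x i - lam p (v k i)) + c k))
    \<le> exp (measure_pmf.expectation (mu_n n (1/2)) (\<lambda>e. MAX k\<in>T. 2 * (\<Sum>i<n. v k i * e i) + c k))"
proof (induction n arbitrary: c)
  case 0
  show ?case by (simp add: expectation_mu_n_0)
next
  case (Suc n)
  let ?E = "measure_pmf.expectation (mu_n n (1/2))"
  define R where "R e k = 2 * (\<Sum>i<n. v k i * e i) + c k" for e k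
  define A where "A = ?E (\<lambda>e. MAX k\<in>T. R e k + (v k n - lam p (v k n)))"
  define B where "B = ?E (\<lambda>e. MAX k\<in>T. R e k + (- v k n - lam p (v k n)))"
  define m where "m = tilt p ((A - B) / 2)"
  have m: "-1 \<le> m" "m \<le> 1" using tilt_bounds[OF p, of "(A - B) / 2"] by (auto simp: m_def)
  have "measure_pmf.expectation (mu_n (Suc n) p)
      (\<lambda>x. exp (MAX k\<in>T. (\<Sum>i<Suc n. v k i * x i - lam p (v k i)) + c k))
    = p * measure_pmf.expectation (mu_n n p)
        (\<lambda>x. exp (MAX k\<in>T. (\<Sum>i<n. v k i * x i - lam p (v k i)) + (c k + (v k n - lam p (v k n)))))
    + (1 - p) * measure_pmf.expectation (mu_n n p)
        (\<lambda>x. exp (MAX k\<in>T. (\<Sum>i<n. v k i * x i - lam p (v k i)) + (c k + (- v k n - lam p (v k n)))))"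
    by (subst expectation_mu_n_Suc[OF p]) (simp add: algebra_simps)
  also have "\<dots> \<le> p * exp A + (1 - p) * exp B"
    using p Suc.IH[of "\<lambda>k. c k + (v k n - lam p (v k n))"] Suc.IH[of "\<lambda>k. c k + (- v k n - lam p (v k n))"]
    unfolding A_def B_def R_def by (intro add_mono mult_left_mono) (auto simp: add.assoc)
  also have "\<dots> = exp ((1 + m) / 2 * A + (1 - m) / 2 * B - Ip1 p m)"
    unfolding m_def by (rule gibbs_variational[OF p])
  also have "\<dots> \<le> exp ((?E (\<lambda>e. MAX k\<in>T. R e k + 2 * v k n) + ?E (\<lambda>e. MAX k\<in>T. R e k - 2 * v k n)) / 2)"
  proof -
    \<comment> \<open>Since \<open>m\<close> depends on \<open>e\<close> only through the
      expectations \<open>A\<close> and \<open>B\<close>, the decoupling inequality applies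
      pointwise in \<open>e\<close>.\<close>
    have "(1 + m) / 2 * A + (1 - m) / 2 * B - Ip1 p m
      = ?E (\<lambda>e. (1 + m) / 2 * (MAX k\<in>T. R e k + (v k n - lam p (v k n)))
         + (1 - m) / 2 * (MAX k\<in>T. R e k + (- v k n - lam p (v k n))) - Ip1 p m)"
      unfolding A_def B_def by simp
    also have "\<dots> \<le> ?E (\<lambda>e. ((MAX k\<in>T. R e k + 2 * v k n) + (MAX k\<in>T. R e k - 2 * v k n)) / 2)"
      by (intro integral_mono two_point_decoupling[OF T p m]) simp_all
    also have "\<dots> = (?E (\<lambda>e. MAX k\<in>T. R e k + 2 * v k n) + ?E (\<lambda>e. MAX k\<in>T. R e k - 2 * v k n)) / 2"
      by simp
    finally show ?thesis by simp
  qed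
  also have "\<dots> = exp (measure_pmf.expectation (mu_n (Suc n) (1/2))
      (\<lambda>e. MAX k\<in>T. 2 * (\<Sum>i<Suc n. v k i * e i) + c k))"
    by (subst expectation_mu_n_Suc) (simp_all add: R_def algebra_simps add_divide_distrib)
  finally show ?case .
qed

section \<open>Support functions and duality\<close>

lemma l2n_eq_L2_set: "l2n n x = L2_set x {..<n}"
  by (simp add: l2n_def L2_set_def)

lemma l2n_nonneg [simp]: "0 \<le> l2n n x"
  by (simp add: l2n_def sum_nonneg)

lemma l2n_power2: "(l2n n x)\<^sup>2 = (\<Sum>i<n. (x i)\<^sup>2)"
  by (simp add: l2n_def sum_nonneg)

lemma abs_le_l2n: "i < n \<Longrightarrow> \<bar>x i\<bar> \<le> l2n n x"
  using member_le_L2_set[of "{..<n}" i "\<lambda>i. \<bar>x i\<bar>"] by (simp add: l2n_eq_L2_set L2_set_def)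

lemma cauchy_schwarz_l2n: "(\<Sum>i<n. v i * z i) \<le> l2n n v * l2n n z"
proof -
  have "(\<Sum>i<n. v i * z i) \<le> (\<Sum>i<n. \<bar>v i\<bar> * \<bar>z i\<bar>)"
    by (intro sum_mono) (metis abs_ge_self abs_mult)
  also have "\<dots> \<le> l2n n v * l2n n z"
    unfolding l2n_eq_L2_set by (rule L2_set_mult_ineq)
  finally show ?thesis .
qed

lemma inner_le_of_norm_le: "l2n n v \<le> L \<Longrightarrow> (\<Sum>i<n. v i * z i) \<le> L * l2n n z"
  using cauchy_schwarz_l2n[of v z n] mult_right_mono[of "l2n n v" L "l2n n z"] by simp

definition supp :: "nat \<Rightarrow> (nat \<Rightarrow> real) set \<Rightarrow> (nat \<Rightarrow> real) \<Rightarrow> real" where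
  "supp n V z = (SUP v\<in>V. \<Sum>i<n. v i * z i)"

lemma inner_le_supp:
  assumes "\<And>v. v \<in> V \<Longrightarrow> l2n n v \<le> L" "v \<in> V"
  shows "(\<Sum>i<n. v i * z i) \<le> supp n V z"
  unfolding supp_def
proof (rule cSUP_upper)
  show "bdd_above ((\<lambda>v. \<Sum>i<n. v i * z i) ` V)"
    by (intro bdd_aboveI2[of _ _ "L * l2n n z"]) (intro inner_le_of_norm_le assms(1))
qed fact

lemma supp_le:
  assumes "\<And>v. v \<in> V \<Longrightarrow> l2n n v \<le> L" "V \<noteq> {}"
  shows "supp n V z \<le> L * l2n n z"
  unfolding supp_def using assms(2)
  by (rule cSUP_least) (intro inner_le_of_norm_le assms(1))

text \<open>Equivalently, \<open>\<zeta>\<close> lies in \<open>l\<close> times the closed convex hull of \<open>V\<close>;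
  the support function makes convexity and the passage to \<open>bV\<close> immediate.\<close>

definition in_scaled_hull :: "nat \<Rightarrow> (nat \<Rightarrow> real) set \<Rightarrow> real \<Rightarrow> (nat \<Rightarrow> real) \<Rightarrow> bool" where
  "in_scaled_hull n V l \<zeta> \<longleftrightarrow> 0 \<le> l \<and> (\<forall>z. (\<Sum>i<n. \<zeta> i * z i) \<le> l * supp n V z)"

lemma in_scaled_hull_0: "in_scaled_hull n V 0 (\<lambda>_. 0)"
  by (simp add: in_scaled_hull_def)

lemma in_scaled_hull_add:
  assumes "\<And>v. v \<in> V \<Longrightarrow> l2n n v \<le> L" "in_scaled_hull n V l \<zeta>" "v \<in> V" "0 \<le> s"
  shows "in_scaled_hull n V (l + s) (\<lambda>i. \<zeta> i + s * v i)"
  unfolding in_scaled_hull_def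
proof (intro conjI allI)
  fix z
  have "(\<Sum>i<n. (\<zeta> i + s * v i) * z i) = (\<Sum>i<n. \<zeta> i * z i) + s * (\<Sum>i<n. v i * z i)"
    by (simp add: sum.distrib sum_distrib_left algebra_simps)
  also have "\<dots> \<le> l * supp n V z + s * supp n V z"
    using assms inner_le_supp[OF assms(1,3), of z]
    by (intro add_mono mult_left_mono) (auto simp: in_scaled_hull_def)
  finally show "(\<Sum>i<n. (\<zeta> i + s * v i) * z i) \<le> (l + s) * supp n V z"
    by (simp add: algebra_simps)
qed (use assms in \<open>auto simp: in_scaled_hull_def\<close>)

lemma in_scaled_hull_scale:
  assumes "in_scaled_hull n V l \<zeta>" "0 \<le> s"
  shows "in_scaled_hull n V (s * l) (\<lambda>i. s * \<zeta> i)"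
proof -
  have "(\<Sum>i<n. s * \<zeta> i * z i) \<le> s * l * supp n V z" for z
    using mult_left_mono[OF _ assms(2), of "\<Sum>i<n. \<zeta> i * z i" "l * supp n V z"] assms
    by (simp add: in_scaled_hull_def sum_distrib_left mult.assoc)
  then show ?thesis using assms by (simp add: in_scaled_hull_def)
qed

text \<open>Test the hull inequality at \<open>z = \<zeta>\<close> and divide by the norm of
  \<open>\<zeta>\<close>.\<close>

lemma in_scaled_hull_norm:
  assumes "\<And>v. v \<in> V \<Longrightarrow> l2n n v \<le> L" "V \<noteq> {}" "in_scaled_hull n V l \<zeta>"
  shows "l2n n \<zeta> \<le> l * L"
proof -
  have "l2n n \<zeta> * l2n n \<zeta> = (\<Sum>i<n. \<zeta> i * \<zeta> i)"
    using l2n_power2[of n \<zeta>] by (simp add: power2_eq_square)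
  also have "\<dots> \<le> l * supp n V \<zeta>"
    using assms(3) by (simp add: in_scaled_hull_def)
  also have "\<dots> \<le> l * (L * l2n n \<zeta>)"
    using supp_le[OF assms(1,2)] assms(3) by (intro mult_left_mono) (auto simp: in_scaled_hull_def)
  finally have *: "l2n n \<zeta> * l2n n \<zeta> \<le> l * L * l2n n \<zeta>" by simp
  show ?thesis
  proof (cases "l2n n \<zeta> = 0")
    case True
    obtain v where "v \<in> V" using assms(2) by auto
    then have "0 \<le> L" using assms(1) l2n_nonneg order_trans by blast
    then show ?thesis using True assms(3) by (simp add: in_scaled_hull_def)
  next
    case False
    then show ?thesis using * l2n_nonneg[of n \<zeta>] by (simp add: less_le)
  qed
qed

text \<open>The log-likelihood ratio at a vertex \<open>x\<close> of the product measure tilted by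
  \<open>\<zeta>\<close> against \<open>mu_n n p\<close>.\<close>

definition dual :: "nat \<Rightarrow> real \<Rightarrow> (nat \<Rightarrow> real) \<Rightarrow> (nat \<Rightarrow> real) \<Rightarrow> real" where
  "dual n p x \<zeta> = (\<Sum>i<n. \<zeta> i * x i - lam p (\<zeta> i))"

lemma dual_le:
  assumes "0 < p" "p < 1" "\<And>i. i < n \<Longrightarrow> -1 \<le> x i \<and> x i \<le> 1"
  shows "dual n p x \<zeta> \<le> (\<Sum>i<n. Ip1 p (x i))"
  unfolding dual_def using assms by (intro sum_mono fenchel_young) auto

text \<open>The gradient of \<open>dual n p x\<close> at \<open>\<zeta>\<close> has coordinates
  \<open>x i - tilt p (\<zeta> i)\<close>; \<open>lam_smooth\<close> controls the remainder in each
  coordinate.\<close>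

lemma dual_smooth:
  assumes "0 < p" "p < 1" and small: "\<And>i. i < n \<Longrightarrow> \<bar>s * w i\<bar> \<le> 1"
  shows "dual n p x \<zeta> + s * (\<Sum>i<n. w i * (x i - tilt p (\<zeta> i))) - s\<^sup>2 * (l2n n w)\<^sup>2
    \<le> dual n p x (\<lambda>i. \<zeta> i + s * w i)"
proof -
  have "dual n p x \<zeta> + s * (\<Sum>i<n. w i * (x i - tilt p (\<zeta> i))) - s\<^sup>2 * (l2n n w)\<^sup>2
    = (\<Sum>i<n. \<zeta> i * x i - lam p (\<zeta> i) + s * (w i * (x i - tilt p (\<zeta> i))) - (s * w i)\<^sup>2)"
    by (simp add: dual_def l2n_power2 sum_distrib_left sum.distrib sum_subtractf power_mult_distrib)
  also have "\<dots> \<le> dual n p x (\<lambda>i. \<zeta> i + s * w i)"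
    unfolding dual_def
  proof (intro sum_mono)
    fix i assume "i \<in> {..<n}"
    then show "\<zeta> i * x i - lam p (\<zeta> i) + s * (w i * (x i - tilt p (\<zeta> i))) - (s * w i)\<^sup>2
        \<le> (\<zeta> i + s * w i) * x i - lam p (\<zeta> i + s * w i)"
      using lam_smooth[OF assms(1,2) small, of i "\<zeta> i"] by (simp add: algebra_simps)
  qed
  finally show ?thesis .
qed

text \<open>Separates the pairing from the entropy of the tilted mean; \<open>dual_witness\<close>
  bounds the two from below by different perturbations.\<close>

lemma dual_tilt:
  assumes "0 < p" "p < 1"
  shows "dual n p x \<zeta> = (\<Sum>i<n. \<zeta> i * (x i - tilt p (\<zeta> i))) + (\<Sum>i<n. Ip1 p (tilt p (\<zeta> i)))"
  unfolding dual_def sum.distrib[symmetric]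
  by (intro sum.cong) (simp_all add: Ip1_tilt[OF assms] algebra_simps)

text \<open>A near-maximiser of \<open>dual \<zeta> - l * \<delta> / 2\<close> over the cone of all \<open>(l, \<zeta>)\<close>. Moving it along
  \<open>v \<in> V\<close> shows that the tilted mean \<open>y\<close> has \<open>\<langle>v, x - y\<rangle> < \<delta>\<close> for all \<open>v\<close>, so its entropy exceeds \<open>r\<close>;
  shrinking it bounds \<open>\<langle>\<zeta>, x - y\<rangle>\<close> from below. Together this is a minimax theorem
  for the convex body \<open>{I\<^sub>p \<le> r}\<close> with additive error 1.\<close>

lemma dual_witness:
  fixes V :: "(nat \<Rightarrow> real) set"
  assumes p: "0 < p" "p < 1"
    and L: "\<And>v. v \<in> V \<Longrightarrow> l2n n v \<le> L" and V: "V \<noteq> {}" and \<delta>: "0 < \<delta>"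
    and x: "\<And>i. i < n \<Longrightarrow> -1 \<le> x i \<and> x i \<le> 1"
    and M: "(\<Sum>i<n. Ip1 p (x i)) \<le> M"
    and sep: "\<And>y. y \<in> cube n \<Longrightarrow> (\<Sum>i<n. Ip1 p (y i)) \<le> r \<Longrightarrow> \<exists>v\<in>V. \<delta> \<le> (\<Sum>i<n. v i * (x i - y i))"
  obtains l \<zeta> where "in_scaled_hull n V l \<zeta>" "l * \<delta> \<le> 2 * (M + 1)" "r + l * \<delta> / 2 - 1 \<le> dual n p x \<zeta>"
proof -
  define E where "E l \<zeta> = dual n p x \<zeta> - l * \<delta> / 2" for l \<zeta>
  define S where "S = (\<lambda>(l, \<zeta>). E l \<zeta>) ` {(l, \<zeta>). in_scaled_hull n V l \<zeta>}"
  have L0: "0 \<le> L" using V L l2n_nonneg by (metis all_not_in_conv order_trans)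
  have E_le: "E l \<zeta> \<le> M - l * \<delta> / 2" for l \<zeta>
    using order_trans[OF dual_le[OF p, of n x \<zeta>] M] x unfolding E_def by simp
  have bdd: "bdd_above S"
    unfolding S_def
  proof (intro bdd_aboveI2[of _ _ M])
    fix q assume "q \<in> {(l, \<zeta>). in_scaled_hull n V l \<zeta>}"
    then obtain l \<zeta> where q: "q = (l, \<zeta>)" "0 \<le> l" by (auto simp: in_scaled_hull_def)
    then have "0 \<le> l * \<delta> / 2" using \<delta> by simp
    then show "(\<lambda>(l, \<zeta>). E l \<zeta>) q \<le> M" using E_le[of l \<zeta>] q by simp
  qed
  have le_Sup: "E l \<zeta> \<le> Sup S" if "in_scaled_hull n V l \<zeta>" for l \<zeta>
    using that bdd by (intro cSup_upper) (auto simp: S_def)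
  have zero: "0 \<le> Sup S"
    using le_Sup[OF in_scaled_hull_0] by (simp add: E_def dual_def lam_0)
  have M0: "0 \<le> M"
    using M sum_nonneg[of "{..<n}" "\<lambda>i. Ip1 p (x i)"] Ip1_nonneg[OF p] x by force
  \<comment> \<open>\<open>R\<close> will bound \<open>l\<close> at a near-maximiser, and
    \<open>B\<close> dominates \<open>L\<close>, \<open>R * L\<close> and their squares, so one step
    size \<open>s\<close> serves both perturbations.\<close>
  define R where "R = 2 * (M + 1) / \<delta>"
  have R0: "0 \<le> R" using M0 \<delta> by (simp add: R_def)
  define B where "B = (L + 1)\<^sup>2 * (R + 1)\<^sup>2"
  \<comment> \<open>The bound \<open>\<delta> / 8\<close> gives
    \<open>2 * \<theta> + \<delta> / 2 < \<delta>\<close>, the contradiction along \<open>v\<close>;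
    the bound \<open>1 / 2\<close> keeps the loss \<open>2 * \<theta>\<close> under shrinking at
    most 1.\<close>
  define \<theta> where "\<theta> = min (\<delta> / 8) (1 / 2)"
  define s where "s = min 1 (\<theta> / B)"
  have \<theta>: "0 < \<theta>" "\<theta> \<le> \<delta> / 8" "\<theta> \<le> 1 / 2" using \<delta> by (auto simp: \<theta>_def)
  have LL: "1 \<le> (L + 1)\<^sup>2" "1 \<le> (R + 1)\<^sup>2" using L0 R0 by (simp_all add: one_le_power)
  have B1: "1 \<le> B" using mult_mono[OF LL] by (simp add: B_def)
  have s: "0 < s" "s \<le> 1" using \<theta> B1 by (auto simp: s_def)
  have "s * B \<le> \<theta> / B * B" using B1 by (intro mult_right_mono) (auto simp: s_def)
  then have sB: "s * B \<le> \<theta>" using B1 by simp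
  have small: "s * a \<le> \<theta>" if "a \<le> B" for a
    using mult_left_mono[OF that, of s] s sB by linarith
  have L_B: "L\<^sup>2 \<le> B" "L \<le> B" and RL_B: "(R * L)\<^sup>2 \<le> B" "R * L \<le> B"
  proof -
    have a: "L\<^sup>2 \<le> (L + 1)\<^sup>2" "L \<le> (L + 1)\<^sup>2" "R\<^sup>2 \<le> (R + 1)\<^sup>2" "R \<le> (R + 1)\<^sup>2" "0 \<le> (R + 1)\<^sup>2"
      using L0 R0 by (auto simp: power2_eq_square algebra_simps)
    show "L\<^sup>2 \<le> B" "L \<le> B" using mult_mono[OF a(1) LL(2)] mult_mono[OF a(2) LL(2)] by (auto simp: B_def)
    show "(R * L)\<^sup>2 \<le> B" "R * L \<le> B"
      using mult_mono[OF a(1,3)] mult_mono[OF a(2,4)] L0 R0 by (auto simp: B_def power_mult_distrib mult.commute)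
  qed
  \<comment> \<open>The optimality gap is proportional to the step \<open>s\<close>, so that after
    division by \<open>s\<close> it costs only \<open>\<theta>\<close>.\<close>
  define \<epsilon> where "\<epsilon> = s * \<theta>"
  have \<epsilon>: "0 < \<epsilon>" "\<epsilon> \<le> 1" using s \<theta> by (auto simp: \<epsilon>_def intro: mult_le_one)
  have "S \<noteq> {}" using in_scaled_hull_0 by (auto simp: S_def)
  then obtain l \<zeta> where lz: "in_scaled_hull n V l \<zeta>" and near: "Sup S - \<epsilon> < E l \<zeta>"
    using less_cSupD[of S "Sup S - \<epsilon>"] \<epsilon> by (auto simp: S_def)
  have l0: "0 \<le> l" using lz by (simp add: in_scaled_hull_def)
  \<comment> \<open>The zero element of the cone has value 0, so a near-maximiser has value above
    -1, while \<open>E_le\<close> bounds it by \<open>M - l * \<delta> / 2\<close>.\<close>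
  have l\<delta>: "l * \<delta> \<le> 2 * (M + 1)"
    using E_le[of l \<zeta>] near zero \<epsilon> by simp
  then have lR: "l \<le> R" using \<delta> by (simp add: R_def field_simps)
  have \<zeta>_norm: "l2n n \<zeta> \<le> R * L"
    using in_scaled_hull_norm[OF L V lz] mult_right_mono[OF lR L0] by linarith
  define y where "y i = (if i < n then tilt p (\<zeta> i) else 0)" for i
  have y_cube: "y \<in> cube n"
    using tilt_bounds[OF p] by (auto simp: cube_def inRn_def y_def intro: less_imp_le)
  have "r < (\<Sum>i<n. Ip1 p (y i))"
  proof (rule ccontr)
    assume "\<not> ?thesis"
    then obtain v where v: "v \<in> V" "\<delta> \<le> (\<Sum>i<n. v i * (x i - y i))"
      using sep[OF y_cube] by auto
    have "\<bar>s * v i\<bar> \<le> 1" if "i < n" for i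
    proof -
      have "s * \<bar>v i\<bar> \<le> s * L"
        using abs_le_l2n[OF that, of v] L[OF v(1)] s by (intro mult_left_mono) auto
      moreover have "\<bar>s * v i\<bar> = s * \<bar>v i\<bar>" using s by (simp add: abs_mult)
      ultimately show ?thesis using small[OF L_B(2)] \<theta> by linarith
    qed
    from dual_smooth[OF p this, where \<zeta> = \<zeta> and x = x]
    have "dual n p x \<zeta> + s * (\<Sum>i<n. v i * (x i - y i)) - s * (s * (l2n n v)\<^sup>2)
        \<le> dual n p x (\<lambda>i. \<zeta> i + s * v i)"
      by (simp add: y_def power2_eq_square mult.assoc)
    moreover have "s * \<delta> \<le> s * (\<Sum>i<n. v i * (x i - y i))"
      using v s by (intro mult_left_mono) auto
    moreover have "s * (s * (l2n n v)\<^sup>2) \<le> s * \<theta>"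
    proof -
      have "(l2n n v)\<^sup>2 \<le> L\<^sup>2" using L[OF v(1)] by (intro power_mono) auto
      then show ?thesis using small L_B(1) s by (intro mult_left_mono) auto
    qed
    moreover have "E (l + s) (\<lambda>i. \<zeta> i + s * v i) < E l \<zeta> + s * \<theta>"
      using le_Sup[OF in_scaled_hull_add[OF L lz v(1), of s]] s near by (simp add: \<epsilon>_def)
    moreover have "(l + s) * \<delta> / 2 = l * \<delta> / 2 + s * \<delta> / 2" by (simp add: field_simps)
    moreover have "s * (\<theta> + \<theta> + \<delta> / 2) = s * \<theta> + s * \<theta> + s * \<delta> / 2" by (simp add: distrib_left)
    \<comment> \<open>The gain \<open>s * \<delta>\<close> competes with the penalty
      \<open>s * \<delta> / 2\<close>, the quadratic error and the optimality gap.\<close>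
    ultimately have "s * \<delta> < s * (\<theta> + \<theta> + \<delta> / 2)"
      unfolding E_def by linarith
    then have "\<delta> < \<theta> + \<theta> + \<delta> / 2"
      using s mult_less_cancel_left_pos by blast
    then show False using \<theta> \<delta> by linarith
  qed
  then have "r \<le> (\<Sum>i<n. Ip1 p (tilt p (\<zeta> i)))" by (simp add: y_def)
  moreover have "l * \<delta> / 2 - 1 \<le> (\<Sum>i<n. \<zeta> i * (x i - tilt p (\<zeta> i)))"
  proof -
    have "\<bar>(- s) * \<zeta> i\<bar> \<le> 1" if "i < n" for i
    proof -
      have "s * \<bar>\<zeta> i\<bar> \<le> s * (R * L)"
        using abs_le_l2n[OF that, of \<zeta>] \<zeta>_norm s by (intro mult_left_mono) auto
      moreover have "\<bar>(- s) * \<zeta> i\<bar> = s * \<bar>\<zeta> i\<bar>" using s by (simp add: abs_mult)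
      ultimately show ?thesis using small[OF RL_B(2)] \<theta> by linarith
    qed
    \<comment> \<open>A step \<open>- s\<close> along \<open>\<zeta>\<close> itself;
      \<open>s \<le> 1\<close> keeps the shrunken pair in the cone.\<close>
    from dual_smooth[OF p this, where \<zeta> = \<zeta> and x = x]
    have "dual n p x \<zeta> - s * (\<Sum>i<n. \<zeta> i * (x i - tilt p (\<zeta> i))) - s * (s * (l2n n \<zeta>)\<^sup>2)
        \<le> dual n p x (\<lambda>i. (1 - s) * \<zeta> i)"
      by (simp add: power2_eq_square mult.assoc left_diff_distrib)
    moreover have "s * (s * (l2n n \<zeta>)\<^sup>2) \<le> s * \<theta>"
    proof -
      have "(l2n n \<zeta>)\<^sup>2 \<le> (R * L)\<^sup>2" using \<zeta>_norm by (intro power_mono) auto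
      then show ?thesis using small RL_B(1) s by (intro mult_left_mono) auto
    qed
    moreover have "E ((1 - s) * l) (\<lambda>i. (1 - s) * \<zeta> i) < E l \<zeta> + s * \<theta>"
      using le_Sup[OF in_scaled_hull_scale[OF lz, of "1 - s"]] s near by (simp add: \<epsilon>_def)
    moreover have "(1 - s) * l * \<delta> / 2 = l * \<delta> / 2 - s * (l * \<delta> / 2)" by (simp add: field_simps)
    ultimately have "s * (l * \<delta> / 2) < s * \<theta> + s * \<theta> + s * (\<Sum>i<n. \<zeta> i * (x i - tilt p (\<zeta> i)))"
      unfolding E_def by linarith
    then have "s * (l * \<delta> / 2) < s * (\<theta> + \<theta> + (\<Sum>i<n. \<zeta> i * (x i - tilt p (\<zeta> i))))"
      by (simp only: distrib_left)
    then have "l * \<delta> / 2 < \<theta> + \<theta> + (\<Sum>i<n. \<zeta> i * (x i - tilt p (\<zeta> i)))"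
      using s mult_less_cancel_left_pos by blast
    then show ?thesis using \<theta> by linarith
  qed
  ultimately have "r + l * \<delta> / 2 - 1 \<le> dual n p x \<zeta>"
    unfolding dual_tilt[OF p] by linarith
  then show thesis using that lz l\<delta> by blast
qed

section \<open>Gradients on the cube\<close>

lemma cube_subset_obox: "0 < \<epsilon> \<Longrightarrow> cube n \<subseteq> obox n \<epsilon>"
  by (auto simp: cube_def obox_def abs_le_iff abs_less_iff)

lemma cube_segment:
  assumes "x \<in> cube n" "y \<in> cube n" "0 \<le> s" "s \<le> 1"
  shows "(\<lambda>i. y i + s * (x i - y i)) \<in> cube n"
proof -
  have "-1 \<le> y i + s * (x i - y i) \<and> y i + s * (x i - y i) \<le> 1" if "i < n" for i
  proof -
    have "y i + s * (x i - y i) = (1 - s) * y i + s * x i" by (simp add: algebra_simps)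
    moreover have "(1 - s) * -1 + s * -1 \<le> (1 - s) * y i + s * x i"
      using assms that by (intro add_mono mult_left_mono) (auto simp: cube_def)
    moreover have "(1 - s) * y i + s * x i \<le> (1 - s) * 1 + s * 1"
      using assms that by (intro add_mono mult_left_mono) (auto simp: cube_def)
    ultimately show ?thesis by simp
  qed
  then show ?thesis using assms by (auto simp: cube_def inRn_def)
qed

text \<open>Coordinates from \<open>n\<close> on are frozen at 0, so the cube is a full product of
  compact sets and Tychonoff applies.\<close>

lemma compact_cube: "compact (cube n)"
proof -
  have "cube n = Pi\<^sub>E UNIV (\<lambda>i. if i < n then {-1..1} else {0})"
    by (auto simp: cube_def inRn_def PiE_iff split: if_splits)
  moreover have "compactin (product_topology (\<lambda>_. euclidean) UNIV)
      (Pi\<^sub>E UNIV (\<lambda>i. if i < n then {-1..1} else {0 :: real}))"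
    by (subst compactin_PiE) auto
  ultimately show ?thesis
    by (simp add: euclidean_product_topology)
qed

lemma l2n_diff_le: "l2n n x \<le> l2n n y + l2n n (\<lambda>i. x i - y i)"
  using L2_set_triangle_ineq[of y "\<lambda>i. x i - y i" "{..<n}"] by (simp add: l2n_eq_L2_set)

lemma l2n_less:
  assumes "\<And>i. i < n \<Longrightarrow> \<bar>x i\<bar> < d / (real n + 1)" "0 < d"
  shows "l2n n x < d"
proof -
  have "l2n n x \<le> (\<Sum>i<n. \<bar>x i\<bar>)"
    unfolding l2n_eq_L2_set by (rule L2_set_le_sum_abs)
  also have "\<dots> \<le> (\<Sum>i<n. d / (real n + 1))"
    using assms(1) by (intro sum_mono) (auto intro: less_imp_le)
  also have "\<dots> < d" using assms(2) by (simp add: field_simps)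
  finally show ?thesis .
qed

text \<open>Compactness lives in the product topology and continuity of \<open>g\<close> in
  \<open>l2n\<close>; coordinate boxes inside \<open>l2n\<close> balls link the two, and a finite
  subcover bounds the norm. Without this bound the supremum \<open>L\<close> would carry no
  information.\<close>

lemma bdd_above_gradient:
  assumes "C1_near_cube n f g"
  shows "bdd_above ((\<lambda>x. l2n n (g x)) ` cube n)"
proof -
  obtain \<epsilon> where \<epsilon>: "0 < \<epsilon>" and cont: "\<And>x e. x \<in> obox n \<epsilon> \<Longrightarrow> 0 < e \<Longrightarrow>
      \<exists>d>0. \<forall>y\<in>obox n \<epsilon>. l2n n (\<lambda>i. y i - x i) < d \<longrightarrow> l2n n (\<lambda>i. g y i - g x i) < e"
    using assms unfolding C1_near_cube_def by auto
  have sub: "cube n \<subseteq> obox n \<epsilon>" by (rule cube_subset_obox[OF \<epsilon>])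
  have "\<exists>d. \<forall>x\<in>cube n. 0 < d x \<and> (\<forall>y\<in>obox n \<epsilon>. l2n n (\<lambda>i. y i - x i) < d x \<longrightarrow> l2n n (\<lambda>i. g y i - g x i) < 1)"
    using cont[of _ 1] sub by (intro bchoice) auto
  then obtain d where d: "\<And>x. x \<in> cube n \<Longrightarrow> 0 < d x"
    "\<And>x y. x \<in> cube n \<Longrightarrow> y \<in> obox n \<epsilon> \<Longrightarrow> l2n n (\<lambda>i. y i - x i) < d x \<Longrightarrow> l2n n (\<lambda>i. g y i - g x i) < 1"
    by blast
  define U where "U x = (\<Inter>i\<in>{..<n}. {y :: nat \<Rightarrow> real. \<bar>y i - x i\<bar> < d x / (real n + 1)})" for x
  have "open (U x)" for x
    unfolding U_def by (intro open_INT open_Collect_less continuous_intros ballI finite_lessThan) auto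
  moreover have "cube n \<subseteq> (\<Union>x\<in>cube n. U x)"
    using d(1) by (force simp: U_def)
  ultimately obtain C where C: "C \<subseteq> cube n" "finite C" "cube n \<subseteq> (\<Union>x\<in>C. U x)"
    using compactE_image[OF compact_cube, of "cube n" U n] by metis
  show ?thesis
  proof (intro bdd_aboveI2)
    fix y assume y: "y \<in> cube n"
    then obtain x where x: "x \<in> C" "y \<in> U x" using C by auto
    then have xc: "x \<in> cube n" using C by auto
    have "l2n n (\<lambda>i. y i - x i) < d x"
      using x d(1)[OF xc] by (intro l2n_less) (auto simp: U_def)
    then have "l2n n (\<lambda>i. g y i - g x i) < 1" using d(2)[OF xc] y sub by auto
    then have "l2n n (g y) \<le> l2n n (g x) + 1"
      using l2n_diff_le[of n "g y" "g x"] by linarith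
    also have "\<dots> \<le> (\<Sum>x\<in>C. l2n n (g x)) + 1"
      using member_le_sum[OF x(1), of "\<lambda>x. l2n n (g x)"] C by simp
    finally show "l2n n (g y) \<le> (\<Sum>x\<in>C. l2n n (g x)) + 1" .
  qed
qed

lemma has_gradient_n_line:
  assumes "has_gradient_n n f v (\<lambda>i. y i + s * w i)" "inRn n w"
  shows "((\<lambda>s. f (\<lambda>i. y i + s * w i)) has_real_derivative (\<Sum>i<n. v i * w i)) (at s)"
  unfolding DERIV_def LIM_eq
proof (intro allI impI)
  fix e :: real assume e: "0 < e"
  \<comment> \<open>Adding 1 keeps the denominator positive when \<open>w\<close> vanishes.\<close>
  let ?e = "e / (2 * (l2n n w + 1))"
  have W: "0 < l2n n w + 1" by (simp add: add_nonneg_pos)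
  then have "0 < ?e" using e by simp
  then obtain d where d: "0 < d" and grad: "\<And>h. inRn n h \<Longrightarrow> l2n n h < d \<Longrightarrow>
      \<bar>f (\<lambda>i. y i + s * w i + h i) - f (\<lambda>i. y i + s * w i) - (\<Sum>i<n. v i * h i)\<bar> \<le> ?e * l2n n h"
    using assms(1) unfolding has_gradient_n_def by meson
  have scale: "l2n n (\<lambda>i. t * w i) = \<bar>t\<bar> * l2n n w" for t
    by (simp add: l2n_def power_mult_distrib real_sqrt_mult flip: sum_distrib_left)
  show "\<exists>d>0. \<forall>t. t \<noteq> 0 \<and> norm (t - 0) < d \<longrightarrow>
      norm ((f (\<lambda>i. y i + (s + t) * w i) - f (\<lambda>i. y i + s * w i)) / t - (\<Sum>i<n. v i * w i)) < e"
  proof (intro exI conjI allI impI)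
    show "0 < d / (l2n n w + 1)" using d W by simp
    fix t :: real assume t: "t \<noteq> 0 \<and> norm (t - 0) < d / (l2n n w + 1)"
    then have "\<bar>t\<bar> * (l2n n w + 1) < d" using W by (simp add: field_simps)
    then have "l2n n (\<lambda>i. t * w i) < d" unfolding scale by (simp add: algebra_simps)
    moreover have "inRn n (\<lambda>i. t * w i)" using assms(2) by (simp add: inRn_def)
    ultimately have "\<bar>f (\<lambda>i. y i + s * w i + t * w i) - f (\<lambda>i. y i + s * w i) - (\<Sum>i<n. v i * (t * w i))\<bar>
        \<le> ?e * (\<bar>t\<bar> * l2n n w)"
      using grad[of "\<lambda>i. t * w i"] unfolding scale by blast
    moreover have "(\<Sum>i<n. v i * (t * w i)) = t * (\<Sum>i<n. v i * w i)"
      by (simp add: sum_distrib_left algebra_simps)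
    moreover have "(\<lambda>i. y i + s * w i + t * w i) = (\<lambda>i. y i + (s + t) * w i)"
      by (simp add: algebra_simps)
    moreover have "?e * (\<bar>t\<bar> * l2n n w) < e * \<bar>t\<bar>"
    proof -
      have "?e * l2n n w < e"
      proof -
        have "e * l2n n w < e * (2 * (l2n n w + 1))"
          using e by (intro mult_strict_left_mono) (auto simp: add_nonneg_pos)
        then show ?thesis using W by (simp add: field_simps)
      qed
      then have "\<bar>t\<bar> * (?e * l2n n w) < \<bar>t\<bar> * e" using t by (intro mult_strict_left_mono) auto
      then show ?thesis by (simp add: algebra_simps)
    qed
    ultimately have "\<bar>f (\<lambda>i. y i + (s + t) * w i) - f (\<lambda>i. y i + s * w i) - t * (\<Sum>i<n. v i * w i)\<bar> < e * \<bar>t\<bar>"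
      by simp
    moreover have "(f (\<lambda>i. y i + (s + t) * w i) - f (\<lambda>i. y i + s * w i)) / t - (\<Sum>i<n. v i * w i)
        = (f (\<lambda>i. y i + (s + t) * w i) - f (\<lambda>i. y i + s * w i) - t * (\<Sum>i<n. v i * w i)) / t"
      using t by (simp add: field_simps)
    ultimately show "norm ((f (\<lambda>i. y i + (s + t) * w i) - f (\<lambda>i. y i + s * w i)) / t - (\<Sum>i<n. v i * w i)) < e"
      using t by (simp add: field_simps)
  qed
qed

text \<open>The one-variable mean value theorem on the segment from \<open>y\<close> to
  \<open>x\<close>; convexity keeps the intermediate point in the cube.\<close>

lemma mean_value_cube:
  assumes "C1_near_cube n f g" "x \<in> cube n" "y \<in> cube n"
  obtains v where "v \<in> g ` cube n" "f x - f y = (\<Sum>i<n. v i * (x i - y i))"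
proof -
  obtain \<epsilon> where \<epsilon>: "0 < \<epsilon>" and grad: "\<And>x. x \<in> obox n \<epsilon> \<Longrightarrow> has_gradient_n n f (g x) x"
    using assms(1) unfolding C1_near_cube_def by auto
  define w where "w s = (\<lambda>i. y i + s * (x i - y i))" for s
  have w: "w s \<in> cube n" if "0 \<le> s" "s \<le> 1" for s
    using cube_segment[OF assms(2,3) that] by (simp add: w_def)
  have "((\<lambda>s. f (w s)) has_real_derivative (\<Sum>i<n. g (w s) i * (x i - y i))) (at s)" if "0 \<le> s" "s \<le> 1" for s
  proof -
    have "has_gradient_n n f (g (w s)) (w s)" using grad w[OF that] cube_subset_obox[OF \<epsilon>] by auto
    moreover have "inRn n (\<lambda>i. x i - y i)" using assms(2,3) by (auto simp: cube_def inRn_def)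
    ultimately show ?thesis unfolding w_def by (rule has_gradient_n_line)
  qed
  from MVT2[of 0 1, OF _ this] obtain s where
    "0 < s" "s < 1" "f (w 1) - f (w 0) = (\<Sum>i<n. g (w s) i * (x i - y i))" by auto
  then show thesis using that[of "g (w s)"] w[of s] by (simp add: w_def)
qed

section \<open>Tail bound\<close>

text \<open>An exponential Markov inequality: each \<open>x\<close> in \<open>A\<close> is itself an
  index of the maximum, which is therefore at least 0 on \<open>A\<close>. The hull condition then
  bounds the Rademacher maximum by the support function of \<open>V\<close>.\<close>

lemma prob_le_of_dual_ge:
  assumes p: "0 < p" "p < 1" and A: "finite A"
    and hull: "\<And>x. x \<in> A \<Longrightarrow> in_scaled_hull n V l (\<zeta> x)"
    and dual: "\<And>x. x \<in> A \<Longrightarrow> a \<le> dual n p x (\<zeta> x)"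
  shows "measure_pmf.prob (mu_n n p) A \<le> exp (2 * l * bV n V - a)"
proof (cases "A = {}")
  case False
  let ?D = "\<lambda>x. MAX k\<in>A. (\<Sum>i<n. \<zeta> k i * x i - lam p (\<zeta> k i)) + - a"
  have "measure_pmf.prob (mu_n n p) A = measure_pmf.expectation (mu_n n p) (indicator A)"
    by simp
  also have "\<dots> \<le> measure_pmf.expectation (mu_n n p) (\<lambda>x. exp (?D x))"
  proof (rule integral_mono)
    fix x
    show "indicator A x \<le> exp (?D x)"
    proof (cases "x \<in> A")
      case True
      then have "(\<Sum>i<n. \<zeta> x i * x i - lam p (\<zeta> x i)) + - a \<le> ?D x"
        by (intro Max_image_ge[OF A, where F = "\<lambda>k. (\<Sum>i<n. \<zeta> k i * x i - lam p (\<zeta> k i)) + - a"])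
      then show ?thesis using dual[OF True] True by (simp add: dual_def)
    qed simp
  qed simp_all
  also have "\<dots> \<le> exp (measure_pmf.expectation (mu_n n (1/2)) (\<lambda>e. MAX k\<in>A. 2 * (\<Sum>i<n. \<zeta> k i * e i) + - a))"
    by (rule bernoulli_process_integrability[OF A False p])
  also have "\<dots> \<le> exp (measure_pmf.expectation (mu_n n (1/2)) (\<lambda>e. 2 * l * supp n V e - a))"
  proof -
    have "(MAX k\<in>A. 2 * (\<Sum>i<n. \<zeta> k i * e i) + - a) \<le> 2 * l * supp n V e - a" for e
      using hull by (intro Max_image_le[OF A False]) (simp add: in_scaled_hull_def mult.assoc)
    then show ?thesis by (simp only: exp_le_cancel_iff) (intro integral_mono; simp)
  qed
  also have "\<dots> = exp (2 * l * bV n V - a)"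
    by (simp add: bV_def supp_def)
  finally show ?thesis .
qed simp

text \<open>The factor 2 counts the linear term and \<open>lam p\<close>, each 1-Lipschitz. Used to
  pay for rounding \<open>l\<close>.\<close>

lemma dual_lipschitz:
  assumes "0 < p" "p < 1" "\<And>i. i < n \<Longrightarrow> \<bar>x i\<bar> \<le> 1"
  shows "dual n p x \<zeta> - 2 * (\<Sum>i<n. \<bar>w i\<bar>) \<le> dual n p x (\<lambda>i. \<zeta> i + w i)"
proof -
  have "dual n p x \<zeta> - 2 * (\<Sum>i<n. \<bar>w i\<bar>) = (\<Sum>i<n. \<zeta> i * x i - lam p (\<zeta> i) - 2 * \<bar>w i\<bar>)"
    by (simp add: dual_def sum_subtractf sum_distrib_left)
  also have "\<dots> \<le> dual n p x (\<lambda>i. \<zeta> i + w i)"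
    unfolding dual_def
  proof (intro sum_mono)
    fix i assume "i \<in> {..<n}"
    then have "\<bar>w i * x i\<bar> \<le> \<bar>w i\<bar>" using assms(3) by (simp add: abs_mult mult_left_le)
    then show "\<zeta> i * x i - lam p (\<zeta> i) - 2 * \<bar>w i\<bar> \<le> (\<zeta> i + w i) * x i - lam p (\<zeta> i + w i)"
      using lam_lipschitz[OF assms(1,2), of "\<zeta> i" "w i"] by (simp add: distrib_right)
  qed
  finally show ?thesis .
qed

text \<open>\<open>2 * max p (1 - p)\<close> is the largest distance from the mean of
  \<open>mu p\<close> to an atom; the surplus factor \<open>21 / 20\<close> keeps the argument of
  the final logarithm away from 1.\<close>

lemma ln_inverse_variance_ge:
  fixes p :: real
  assumes "0 < p" "p < 1"
  shows "2 * max p (1 - p) * (21 / 20) \<le> ln (1 / (p * (1 - p)))"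
proof -
  have main: "2 * q * (21 / 20) \<le> ln (1 / (q * (1 - q)))" if "0 < q" "q < 1" for q :: real
  proof -
    define u where "u = q * (1 - q)"
    have u: "0 < u" using that by (simp add: u_def)
    have "ln (4 * u) \<le> 4 * u - 1" using u by (intro ln_le_minus_one) simp
    moreover have "ln (4 * u) = ln 4 + ln u" using u by (simp add: ln_mult_pos)
    moreover have "ln (4 :: real) = 2 * ln 2" using ln_realpow[of 2 2] by simp
    moreover have "2 * q * (21 / 20) \<le> 4 / 3 + 1 - 4 * u"
    proof -
      \<comment> \<open>The constant \<open>4 / 3\<close> is the lower bound for
        \<open>ln 4\<close>; the difference of the two sides is this square plus a positive
        constant.\<close>
      have "0 \<le> (2 * q - 61 / 40)\<^sup>2" by simp
      then show ?thesis by (simp add: u_def power2_eq_square algebra_simps)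
    qed
    moreover have "ln (1 / u) = - ln u" using u by (simp add: ln_div)
    ultimately show ?thesis using ln2_ge_two_thirds by (simp add: u_def)
  qed
  show ?thesis
    using main[of p] main[of "1 - p"] assms by (simp add: max_def mult.commute)
qed

lemma sum_Ip1_vertex_le:
  assumes p: "0 < p" "p < 1" and x: "\<And>i. i < n \<Longrightarrow> x i = 1 \<or> x i = -1"
  shows "(\<Sum>i<n. Ip1 p (x i)) \<le> real n * ln (1 / (p * (1 - p)))"
proof -
  have "(\<Sum>i<n. Ip1 p (x i)) \<le> (\<Sum>i<n. ln (1 / (p * (1 - p))))"
  proof (intro sum_mono)
    fix i assume "i \<in> {..<n}"
    then have "x i = 1 \<or> x i = -1" using x by simp
    moreover have "Ip1 p 1 = - ln p" "Ip1 p (-1) = - ln (1 - p)"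
    proof -
      have "2 / (2 * (1 - p)) = 1 / (1 - p)" by (rule mult_divide_mult_cancel_left[of 2 1 "1 - p", simplified mult_1_right]) simp
      then show "Ip1 p 1 = - ln p" "Ip1 p (-1) = - ln (1 - p)"
        using p by (simp_all add: Ip1_def ln_div)
    qed
    moreover have "ln (1 / (p * (1 - p))) = - ln p - ln (1 - p)"
      using p by (simp add: ln_div ln_mult)
    moreover have "ln p < 0" "ln (1 - p) < 0" using p by simp_all
    ultimately show "Ip1 p (x i) \<le> ln (1 / (p * (1 - p)))" by auto
  qed
  then show ?thesis by simp
qed

text \<open>Rounds \<open>l\<close> up to mesh \<open>1 / (2 * L * n)\<close> by adding a small
  multiple of some \<open>v\<close> in \<open>V\<close>. This costs at most 1 in \<open>dual\<close>
  and \<open>1 / 2\<close> in the term \<open>l * \<delta> / 2\<close>, whence 3 in place of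
  1.\<close>

lemma witness_on_grid:
  fixes V :: "(nat \<Rightarrow> real) set"
  assumes p: "0 < p" "p < 1" and n: "1 \<le> n"
    and L: "\<And>v. v \<in> V \<Longrightarrow> l2n n v \<le> L" and L0: "0 < L" and V: "V \<noteq> {}" and \<delta>: "0 < \<delta>" "\<delta> \<le> 2 * L * n"
    and x: "\<And>i. i < n \<Longrightarrow> \<bar>x i\<bar> \<le> 1"
    and M: "(\<Sum>i<n. Ip1 p (x i)) \<le> M"
    and sep: "\<And>y. y \<in> cube n \<Longrightarrow> (\<Sum>i<n. Ip1 p (y i)) \<le> r \<Longrightarrow> \<exists>v\<in>V. \<delta> \<le> (\<Sum>i<n. v i * (x i - y i))"
  defines "l \<equiv> \<lambda>j::nat. j / (2 * L * n)"
  obtains j \<zeta> where "j \<le> 4 * (M + 1) * L * n / \<delta> + 1" "in_scaled_hull n V (l j) \<zeta>"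
    "r + l j * \<delta> / 2 - 3 \<le> dual n p x \<zeta>"
proof -
  have K: "0 < 2 * L * n" using L0 n by simp
  have x': "-1 \<le> x i \<and> x i \<le> 1" if "i < n" for i using x[OF that] by (auto simp: abs_le_iff)
  obtain k \<zeta> where k: "in_scaled_hull n V k \<zeta>" "k * \<delta> \<le> 2 * (M + 1)" "r + k * \<delta> / 2 - 1 \<le> dual n p x \<zeta>"
    using dual_witness[OF p L V \<delta>(1) x' M sep] by blast
  have k0: "0 \<le> k" using k by (simp add: in_scaled_hull_def)
  obtain v where v: "v \<in> V" using V by auto
  define j where "j = nat \<lceil>k * (2 * L * n)\<rceil>"
  have j: "k * (2 * L * n) \<le> j" "j \<le> k * (2 * L * n) + 1"
    using k0 K by (auto simp: j_def of_nat_ceiling)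
  define s where "s = l j - k"
  have s: "0 \<le> s" "s \<le> 1 / (2 * L * n)"
    using j K by (auto simp: s_def l_def field_simps)
  have "j \<le> 4 * (M + 1) * L * n / \<delta> + 1"
  proof -
    have "k \<le> 2 * (M + 1) / \<delta>" using k(2) \<delta> by (simp add: field_simps)
    then have "k * (2 * L * n) \<le> 2 * (M + 1) / \<delta> * (2 * L * n)" using K by (intro mult_right_mono) auto
    then show ?thesis using j(2) by (simp add: algebra_simps)
  qed
  moreover have "in_scaled_hull n V (l j) (\<lambda>i. \<zeta> i + s * v i)"
    using in_scaled_hull_add[OF L k(1) v s(1)] by (simp add: s_def)
  moreover have "r + l j * \<delta> / 2 - 3 \<le> dual n p x (\<lambda>i. \<zeta> i + s * v i)"
  proof -
    have "(\<Sum>i<n. \<bar>s * v i\<bar>) \<le> (\<Sum>i<n. s * L)"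
      using abs_le_l2n[of _ n v] L[OF v] s by (intro sum_mono) (force simp: abs_mult intro: mult_left_mono)
    also have "\<dots> = s * (L * n)" by simp
    also have "\<dots> \<le> 1 / (2 * L * n) * (L * n)" using s L0 by (intro mult_right_mono) auto
    also have "\<dots> = 1 / 2" using L0 n by simp
    finally have "2 * (\<Sum>i<n. \<bar>s * v i\<bar>) \<le> 1" by simp
    moreover have "s * \<delta> \<le> 1"
      using mult_mono[OF s(2) \<delta>(2)] \<delta>(1) L0 n by simp
    moreover have "l j * \<delta> / 2 = k * \<delta> / 2 + s * \<delta> / 2" by (simp add: s_def field_simps)
    ultimately show ?thesis
      using dual_lipschitz[where n = n and x = x and \<zeta> = \<zeta> and w = "\<lambda>i. s * v i", OF p x] k(3) by linarith
  qed
  ultimately show thesis by (rule that)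
qed

text \<open>A union bound over the grid index; \<open>bV n V \<le> \<delta> / 4\<close> makes
  \<open>2 * l j * bV n V\<close> at most the gain \<open>l j * \<delta> / 2\<close>.\<close>

lemma prob_le_card_grid:
  fixes V :: "(nat \<Rightarrow> real) set"
  assumes p: "0 < p" "p < 1"
    and b: "bV n V \<le> \<delta> / 4" and l: "\<And>j. j \<le> J \<Longrightarrow> 0 \<le> l j"
    and A: "\<And>x. x \<in> A \<Longrightarrow> \<exists>j\<le>J. \<exists>\<zeta>. in_scaled_hull n V (l j) \<zeta> \<and> r + l j * \<delta> / 2 - 3 \<le> dual n p x \<zeta>"
    and fin: "finite A"
  shows "measure_pmf.prob (mu_n n p) A \<le> real (J + 1) * exp (3 - r)"
proof -
  define B where "B j = {x \<in> A. \<exists>\<zeta>. in_scaled_hull n V (l j) \<zeta> \<and> r + l j * \<delta> / 2 - 3 \<le> dual n p x \<zeta>}" for j :: nat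
  have "measure_pmf.prob (mu_n n p) (B j) \<le> exp (3 - r)" if "j \<le> J" for j
  proof -
    obtain \<zeta> where "\<And>x. x \<in> B j \<Longrightarrow> in_scaled_hull n V (l j) (\<zeta> x)"
      "\<And>x. x \<in> B j \<Longrightarrow> r + l j * \<delta> / 2 - 3 \<le> dual n p x (\<zeta> x)"
      using bchoice[of "B j" "\<lambda>x \<zeta>. in_scaled_hull n V (l j) \<zeta> \<and> r + l j * \<delta> / 2 - 3 \<le> dual n p x \<zeta>"]
      by (auto simp: B_def)
    then have "measure_pmf.prob (mu_n n p) (B j) \<le> exp (2 * l j * bV n V - (r + l j * \<delta> / 2 - 3))"
      using fin by (intro prob_le_of_dual_ge[OF p]) (auto simp: B_def)
    also have "2 * l j * bV n V \<le> 2 * l j * (\<delta> / 4)"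
      using l[OF that] b by (intro mult_left_mono) auto
    then have "exp (2 * l j * bV n V - (r + l j * \<delta> / 2 - 3)) \<le> exp (3 - r)"
      by (simp add: mult.commute)
    finally show ?thesis .
  qed
  then have "(\<Sum>j\<le>J. measure_pmf.prob (mu_n n p) (B j)) \<le> (\<Sum>j\<le>J. exp (3 - r))"
    by (intro sum_mono) auto
  moreover have "measure_pmf.prob (mu_n n p) (\<Union>j\<le>J. B j) \<le> (\<Sum>j\<le>J. measure_pmf.prob (mu_n n p) (B j))"
    by (intro measure_pmf.finite_measure_subadditive_finite) auto
  moreover have "A = (\<Union>j\<le>J. B j)" using A unfolding B_def by fastforce
  ultimately show ?thesis by simp
qed

lemma prob_upper_tail_le:
  fixes f :: "(nat \<Rightarrow> real) \<Rightarrow> real" and g :: "(nat \<Rightarrow> real) \<Rightarrow> nat \<Rightarrow> real"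
  assumes n: "1 \<le> n" and p: "0 < p" "p < 1" and f: "C1_near_cube n f g" and \<delta>: "0 < \<delta>"
    and strict: "\<And>s. t - \<delta> < s \<Longrightarrow> phi n p f (t - \<delta>) < phi n p f s"
    and b: "bV n (g ` cube n) \<le> \<delta> / 4"
  shows "measure_pmf.prob (mu_n n p) {x. f x \<ge> t}
    \<le> exp (- real_of_ereal (phi n p f (t - \<delta>)))
      * (real n * (SUP x\<in>cube n. l2n n (g x)) * ln (1 / (p * (1 - p))) / \<delta>) powr 123"
proof -
  define r where "r = real_of_ereal (phi n p f (t - \<delta>))"
  define L where "L = (SUP x\<in>cube n. l2n n (g x))"
  define \<Lambda> where "\<Lambda> = ln (1 / (p * (1 - p)))"
  define B where "B = real n * L * \<Lambda> / \<delta>"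
  define V where "V = g ` cube n"
  define A where "A = {x. t \<le> f x} \<inter> set_pmf (mu_n n p)"
  have finA: "finite A" using finite_set_mu_n by (simp add: A_def)
  have prob: "measure_pmf.prob (mu_n n p) {x. f x \<ge> t} = measure_pmf.prob (mu_n n p) A"
    unfolding A_def by (rule measure_Int_set_pmf[symmetric])
  show ?thesis
  proof (cases "A = {}")
    case True
    then show ?thesis by (simp add: prob)
  next
    case False
    then obtain x0 where x0: "x0 \<in> A" by auto
    have vertex: "x i = 1 \<or> x i = -1" if "x \<in> A" "i < n" for x i
      using set_mu_n(2)[OF p] that by (auto simp: A_def)
    have A_cube: "x \<in> cube n" if "x \<in> A" for x
      using vertex[OF that] set_mu_n(1)[OF p, of x n] that by (force simp: cube_def A_def)
    have phi_nonneg: "0 \<le> phi n p f s" for s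
      unfolding phi_def
      by (intro Inf_greatest) (auto simp: Ip_def cube_def intro!: sum_nonneg Ip1_nonneg[OF p])
    \<comment> \<open>Strictness at \<open>s = t\<close> rules out the value infinity, so the
      conversion to a real loses nothing.\<close>
    have phi_r: "phi n p f (t - \<delta>) = ereal r"
      using strict[of t] phi_nonneg[of "t - \<delta>"] \<delta> unfolding r_def
      by (cases "phi n p f (t - \<delta>)") auto
    have low: "f y \<le> t - \<delta>" if "y \<in> cube n" "(\<Sum>i<n. Ip1 p (y i)) \<le> r" for y
    proof (rule ccontr)
      assume "\<not> f y \<le> t - \<delta>"
      then have "phi n p f (t - \<delta>) < phi n p f (f y)" by (intro strict) simp
      also have "\<dots> \<le> Ip n p y"
        unfolding phi_def by (rule Inf_lower) (use that in auto)
      finally show False using that by (simp add: phi_r Ip_def)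
    qed
    have sep: "\<exists>v\<in>V. \<delta> \<le> (\<Sum>i<n. v i * (x i - y i))"
      if xy: "x \<in> A" "y \<in> cube n" "(\<Sum>i<n. Ip1 p (y i)) \<le> r" for x y
    proof -
      obtain v where "v \<in> V" "f x - f y = (\<Sum>i<n. v i * (x i - y i))"
        using mean_value_cube[OF f A_cube[OF xy(1)] xy(2)] unfolding V_def by metis
      moreover have "t \<le> f x" using xy by (simp add: A_def)
      ultimately show ?thesis using low[OF xy(2,3)] by (intro bexI[of _ v]) auto
    qed
    have norm_le: "l2n n v \<le> L" if "v \<in> V" for v
      using that unfolding V_def L_def by (auto intro: cSUP_upper bdd_above_gradient[OF f])
    have V: "V \<noteq> {}" using A_cube[OF x0] by (auto simp: V_def)

    define q where "q = 2 * max p (1 - p)"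
    \<comment> \<open>The mean vector has zero entropy and lies in the body; separating
      \<open>x0\<close> from it bounds \<open>\<delta>\<close> by
      \<open>L * (sqrt n * q)\<close>.\<close>
    define m where "m i = (if i < n then 2 * p - 1 else 0)" for i
    have q: "0 < q" "q \<le> 2" using p by (auto simp: q_def)
    have m: "m \<in> cube n" "(\<Sum>i<n. Ip1 p (m i)) = 0"
      using p Ip1_mean[OF p] by (auto simp: m_def cube_def inRn_def)
    have "0 \<le> r" using phi_nonneg[of "t - \<delta>"] by (simp add: phi_r)
    then obtain v where v: "v \<in> V" "\<delta> \<le> (\<Sum>i<n. v i * (x0 i - m i))"
      using sep[OF x0 m(1)] m(2) by auto
    have L0: "0 \<le> L" using norm_le[OF v(1)] l2n_nonneg order_trans by blast
    have "l2n n (\<lambda>i. x0 i - m i) \<le> sqrt (\<Sum>i<n. q\<^sup>2)"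
      unfolding l2n_def
    proof (intro real_sqrt_le_mono sum_mono)
      fix i assume "i \<in> {..<n}"
      then have "\<bar>x0 i - m i\<bar> \<le> q" using vertex[OF x0, of i] p by (auto simp: m_def q_def max_def)
      then show "(x0 i - m i)\<^sup>2 \<le> q\<^sup>2" using q by (simp add: abs_le_square_iff[symmetric])
    qed
    also have "\<dots> = sqrt n * q" using q by (simp add: real_sqrt_mult)
    finally have dist: "l2n n (\<lambda>i. x0 i - m i) \<le> sqrt n * q" .
    have \<delta>_le: "\<delta> \<le> L * (sqrt n * q)"
      using v(2) inner_le_of_norm_le[OF norm_le[OF v(1)], of "\<lambda>i. x0 i - m i"]
        mult_left_mono[OF dist L0] by linarith
    then have Lpos: "0 < L" using L0 \<delta> by (cases "L = 0") auto
    have \<Lambda>_q: "q * (21 / 20) \<le> \<Lambda>" using ln_inverse_variance_ge[OF p] by (simp add: q_def \<Lambda>_def)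
    have \<Lambda>1: "1 \<le> \<Lambda>" using \<Lambda>_q by (simp add: q_def max_def split: if_splits)
    have sn: "1 \<le> sqrt n" "sqrt n \<le> n" "sqrt n * sqrt n = n"
      using n by (auto simp: real_le_lsqrt power2_eq_square)
    have \<delta>_n: "\<delta> \<le> 2 * L * n"
    proof -
      have "sqrt n * q \<le> real n * 2" using sn q by (intro mult_mono) auto
      then have "L * (sqrt n * q) \<le> L * (real n * 2)" using L0 by (intro mult_left_mono) auto
      then show ?thesis using \<delta>_le by (simp add: algebra_simps)
    qed
    \<comment> \<open>This one estimate yields both \<open>21 / 20 \<le> B\<close>, which lets
      powers of \<open>B\<close> absorb constants, and \<open>n \<le> B\<^sup>2\<close>, which
      controls the grid size.\<close>
    have B_ge: "21 / 20 * sqrt n \<le> B"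
    proof -
      have "21 / 20 * sqrt n * \<delta> \<le> 21 / 20 * sqrt n * (L * (sqrt n * q))"
        using \<delta>_le by (intro mult_left_mono) auto
      also have "\<dots> = (sqrt n * sqrt n) * L * (q * (21 / 20))" by (simp only: ac_simps)
      also have "\<dots> \<le> n * L * \<Lambda>" unfolding sn using \<Lambda>_q L0 by (intro mult_left_mono) auto
      finally show ?thesis using \<delta> by (simp add: B_def field_simps)
    qed
    then have B1: "21 / 20 \<le> B" using sn by linarith
    have n_B: "n \<le> B\<^sup>2"
    proof -
      have "sqrt n \<le> B" using B_ge sn by linarith
      then have "(sqrt n)\<^sup>2 \<le> B\<^sup>2" by (intro power_mono) auto
      then show ?thesis by simp
    qed

    define l where "l = (\<lambda>j::nat. j / (2 * L * n))"
    define Jr where "Jr = 4 * (n * \<Lambda> + 1) * L * n / \<delta> + 1"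
    define J where "J = nat \<lfloor>Jr\<rfloor>"
    have Jr0: "0 \<le> Jr" using Lpos \<Lambda>1 \<delta> by (simp add: Jr_def)
    have "measure_pmf.prob (mu_n n p) A \<le> real (J + 1) * exp (3 - r)"
    proof (rule prob_le_card_grid[OF p b[folded V_def], where l = l])
      show "0 \<le> l j" for j using Lpos by (simp add: l_def)
      fix x assume x: "x \<in> A"
      have "\<exists>j \<zeta>. real j \<le> Jr \<and> in_scaled_hull n V (l j) \<zeta> \<and> r + l j * \<delta> / 2 - 3 \<le> dual n p x \<zeta>"
      proof (rule witness_on_grid[OF p n norm_le Lpos V \<delta> \<delta>_n])
        show "\<bar>x i\<bar> \<le> 1" if "i < n" for i using vertex[OF x that] by auto
        show "(\<Sum>i<n. Ip1 p (x i)) \<le> real n * \<Lambda>"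
          unfolding \<Lambda>_def by (rule sum_Ip1_vertex_le[OF p vertex[OF x]])
        show "\<exists>v\<in>V. \<delta> \<le> (\<Sum>i<n. v i * (x i - y i))"
          if "y \<in> cube n" "(\<Sum>i<n. Ip1 p (y i)) \<le> r" for y
          using sep[OF x that] .
      qed (auto simp: Jr_def l_def)
      then obtain j \<zeta> where "j \<le> Jr" "in_scaled_hull n V (l j) \<zeta>" "r + l j * \<delta> / 2 - 3 \<le> dual n p x \<zeta>"
        by auto
      moreover from this have "j \<le> J" unfolding J_def by (simp add: le_nat_floor)
      ultimately show "\<exists>j\<le>J. \<exists>\<zeta>. in_scaled_hull n V (l j) \<zeta> \<and> r + l j * \<delta> / 2 - 3 \<le> dual n p x \<zeta>"
        by blast
    qed (rule finA)
    also have "real (J + 1) \<le> 10 * B ^ 3"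
    proof -
      have n\<Lambda>: "1 \<le> n * \<Lambda>" using mult_mono[of 1 n 1 \<Lambda>] n \<Lambda>1 by simp
      have "real J \<le> Jr" unfolding J_def using Jr0 by (simp add: of_nat_floor)
      also have "Jr \<le> 4 * (n * \<Lambda> + n * \<Lambda>) * L * n / \<delta> + 1"
        unfolding Jr_def using n\<Lambda> Lpos \<delta>
        by (intro add_mono divide_right_mono mult_right_mono) (auto simp: mult.commute)
      also have "\<dots> = 8 * (n * B) + 1" by (simp add: B_def)
      also have "\<dots> \<le> 8 * (B\<^sup>2 * B) + 1"
        using n_B B1 by (intro add_mono mult_left_mono mult_right_mono) auto
      finally have "real (J + 1) \<le> 8 * B ^ 3 + 2" by (simp add: power2_eq_square power3_eq_cube)
      moreover have "1 \<le> B ^ 3" using B1 by (intro one_le_power) simp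
      ultimately show ?thesis by linarith
    qed
    then have "real (J + 1) * exp (3 - r) \<le> 10 * B ^ 3 * exp (3 - r)"
      by (intro mult_right_mono) auto
    also have "\<dots> = 10 * exp 1 ^ 3 * B ^ 3 * exp (- r)"
      by (simp add: exp_diff exp_minus field_simps flip: exp_of_nat_mult)
    \<comment> \<open>The constant is at most 270, which is below \<open>(21 / 20) ^ 120\<close>;
      hence the exponent 120 + 3 = 123.\<close>
    also have "\<dots> \<le> B ^ 120 * B ^ 3 * exp (- r)"
    proof -
      have "10 * exp 1 ^ 3 \<le> 10 * (3 :: real) ^ 3"
        using exp_le by (intro mult_left_mono power_mono) auto
      also have "\<dots> \<le> (21 / 20) ^ 120" by (simp add: power_divide)
      also have "\<dots> \<le> B ^ 120" using B1 by (intro power_mono) auto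
      finally show ?thesis using B1 by (intro mult_right_mono) auto
    qed
    also have "\<dots> = exp (- r) * B powr 123"
      using B1 powr_realpow[of B 123] by (simp flip: power_add)
    finally show ?thesis by (simp add: prob r_def B_def L_def \<Lambda>_def)
  qed
qed

text \<open>The logarithmic estimate appears in exponentiated form, so a vanishing probability needs
  no convention for the logarithm of zero.\<close>

theorem theorem2p12:
  "\<exists>C>0. \<exists>\<kappa>>0. \<forall>(n::nat) (p::real) f g (t::real) (\<delta>::real).
     n \<ge> 1 \<and> 0 < p \<and> p < 1 \<and> C1_near_cube n f g \<and> \<delta> > 0 \<and>
     (\<forall>s>t - \<delta>. phi n p f s > phi n p f (t - \<delta>)) \<and>
     bV n (g ` cube n) \<le> \<delta> / \<kappa>
     \<longrightarrow> measure_pmf.prob (mu_n n p) {x. f x \<ge> t}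
           \<le> exp (- real_of_ereal (phi n p f (t - \<delta>)))
              * (real n * (SUP x\<in>cube n. l2n n (g x)) * ln (1 / (p * (1 - p))) / \<delta>) powr C"
  by (rule exI[of _ 123], rule conjI, simp, rule exI[of _ 4], rule conjI, simp)
    (intro allI impI prob_upper_tail_le; simp)

end
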